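(* Fix $\alpha\in(0,1)$ and consider inputs in which every job is an $\alpha$-long window job, i.e., $d_j-r_j\ge \alpha T+\lambda$. Consider the following online algorithm (Algorithm 1). It maintains a set $\mathcal{I}$ of calibrations (initially empty) and a priority queue $\mathcal{Q}$ of released but unscheduled jobs ordered by increasing deadline. At each time step $t$: (1) insert all jobs released at time $t$ into $\mathcal{Q}$; (2) while there exists a job in $\mathcal{Q}$ with deadline $\le t+\lambda+T+1$ that cannot be feasibly scheduled when all jobs of $\mathcal{Q}$ are virtually scheduled by the EDF algorithm on the calibrated slots of $\mathcal{I}$ during the time interval $[t,t+\lambda+T]$, add to $\mathcal{I}$ a round of calibrations consisting of $\lceil 1/\alpha\rceil$ calibrations starting at time $t$ and one calibration starting at time $t+T$; (3) while $\mathcal{Q}$ is nonempty and there are empty calibrated slots at time $t$, pop the job with the smallest deadline from $\mathcal{Q}$ and schedule it at time $t$. Then Algorithm 1 is $(\lceil 1/\alpha\rceil+1)$-competitive; more precisely, the number of calibrations it uses is at most $(\lceil 1/\alpha\rceil+1)\cdot OPT$.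
   Context: Problem: unlimited identical machines; discrete time. A calibration started at integer time $t$ occupies $[t,t+\lambda+T)$, with activation interval $[t,t+\lambda)$ and calibrated interval $[t+\lambda,t+\lambda+T)$, where $\lambda\ge 0$ is an integer and $T$ a positive integer. Machines process jobs only while calibrated, one job at a time; the calibrated slot of a calibration at time $\tau$ is $[\tau,\tau+1)$ for $\tau$ in its calibrated interval. Each job $j$ has integer release time $r_j$, processing time $1$, integer deadline $d_j$ with $d_j-r_j\ge 1+\lambda$; scheduling $j$ at time $\tau$ is feasible iff $r_j\le\tau$ and $\tau+1\le d_j$. Jobs arrive online (revealed at release time). Objective: minimize the number of calibrations while feasibly scheduling all jobs; $OPT$ is the minimum number. EDF (Earliest Deadline First) on a given calibration set: at each time $\tau$, insert the jobs released at $\tau$ into a queue ordered by deadline, and if there are $m_\tau$ calibrated slots at $\tau$, remove up to $m_\tau$ jobs with smallest deadlines and schedule them at $\tau$. An online algorithm is $c$-competitive if there is a constant $a$ with $ALG(Ins)\le c\cdot OPT(Ins)+a$ for all instances. *)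

theory Defs
  imports Complex_Main "HOL-Library.Multiset" "HOL-Library.While_Combinator"
begin

text \<open>The identifier keeps apart distinct jobs with equal release time and deadline.\<close>

datatype job = Job (job_id: nat) (release: int) (deadline: int)

definition feasible_at :: "job \<Rightarrow> int \<Rightarrow> bool" where
  "feasible_at j \<tau> \<longleftrightarrow> release j \<le> \<tau> \<and> \<tau> + 1 \<le> deadline j"

definition instances :: "int \<Rightarrow> job set set" where
  "instances lam = {J. finite J \<and> (\<forall>j\<in>J. deadline j - release j \<ge> 1 + lam)}"

definition long_window :: "real \<Rightarrow> int \<Rightarrow> int \<Rightarrow> job \<Rightarrow> bool" where
  "long_window \<alpha> lam T j \<longleftrightarrow>
     real_of_int (deadline j - release j) \<ge> \<alpha> * real_of_int T + real_of_int lam"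

definition occupied :: "int \<Rightarrow> int \<Rightarrow> int \<Rightarrow> int set" where
  "occupied lam T s = {s..<s + lam + T}"

definition calibrated :: "int \<Rightarrow> int \<Rightarrow> int \<Rightarrow> int set" where
  "calibrated lam T s = {s + lam..<s + lam + T}"

text \<open>
  A solution is given by the multiset \<open>I\<close> of starting times of its calibrations and the partial
  map \<open>S\<close> from jobs to the times at which they are processed. It is feasible if the calibrations
  and the jobs can be distributed over the machines (numbered by \<^typ>\<open>nat\<close>, hence unlimited);
  \<open>C\<close> is the resulting set of pairs (machine, starting time), \<open>M\<close> the machine of each job.
\<close>

definition feasible_solution ::
  "int \<Rightarrow> int \<Rightarrow> job set \<Rightarrow> int multiset \<Rightarrow> (job \<rightharpoonup> int) \<Rightarrow> bool" where
  "feasible_solution lam T J I S \<longleftrightarrow> dom S = J \<and>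
     (\<exists>(C :: (nat \<times> int) set) (M :: job \<Rightarrow> nat).
        finite C \<and> image_mset snd (mset_set C) = I \<and>
        (\<forall>m s s'. (m, s) \<in> C \<and> (m, s') \<in> C \<and> s \<noteq> s' \<longrightarrow>
           occupied lam T s \<inter> occupied lam T s' = {}) \<and>
        (\<forall>j\<in>J. feasible_at j (the (S j)) \<and>
           (\<exists>s. (M j, s) \<in> C \<and> the (S j) \<in> calibrated lam T s)) \<and>
        inj_on (\<lambda>j. (M j, the (S j))) J)"

definition OPT :: "int \<Rightarrow> int \<Rightarrow> job set \<Rightarrow> nat" where
  "OPT lam T J = (LEAST k. \<exists>I S. feasible_solution lam T J I S \<and> size I = k)"

text \<open>An algorithm returns \<^const>\<open>None\<close> on an instance if it fails to terminate on it.\<close>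

definition competitive ::
  "int \<Rightarrow> int \<Rightarrow> job set set \<Rightarrow> (job set \<Rightarrow> (int multiset \<times> (job \<rightharpoonup> int)) option) \<Rightarrow> real \<Rightarrow> bool" where
  "competitive lam T Ins alg c \<longleftrightarrow>
     (\<exists>a :: real. \<forall>J\<in>Ins. \<exists>I S. alg J = Some (I, S) \<and> feasible_solution lam T J I S \<and>
        real (size I) \<le> c * real (OPT lam T J) + a)"

definition slots :: "int \<Rightarrow> int \<Rightarrow> int multiset \<Rightarrow> int \<Rightarrow> nat" where
  "slots lam T I \<tau> = size {#s \<in># I. \<tau> \<in> calibrated lam T s#}"

text \<open>
  A priority queue is the set of its elements together with a rule \<open>pop\<close> choosing an element of
  smallest deadline; the rule decides how ties are broken.
\<close>

definition smallest_deadline_rule :: "(job set \<Rightarrow> job) \<Rightarrow> bool" where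
  "smallest_deadline_rule pop \<longleftrightarrow>
     (\<forall>Q. finite Q \<and> Q \<noteq> {} \<longrightarrow> pop Q \<in> Q \<and> (\<forall>q\<in>Q. deadline (pop Q) \<le> deadline q))"

fun popped :: "(job set \<Rightarrow> job) \<Rightarrow> nat \<Rightarrow> job set \<Rightarrow> job set" where
  "popped pop 0 Q = {}"
| "popped pop (Suc m) Q =
     (if Q = {} then {} else insert (pop Q) (popped pop m (Q - {pop Q})))"

text \<open>
  EDF from time \<open>s\<close> on, with \<open>m \<tau>\<close> calibrated slots at time \<open>\<tau>\<close> and the jobs \<open>A \<tau>\<close> being released
  at time \<open>\<tau>\<close>: the queue just before time \<open>s + n\<close>, and the jobs scheduled at time \<open>\<tau>\<close>.
\<close>

fun edf_queue ::
  "(job set \<Rightarrow> job) \<Rightarrow> (int \<Rightarrow> nat) \<Rightarrow> (int \<Rightarrow> job set) \<Rightarrow> int \<Rightarrow> nat \<Rightarrow> job set" where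
  "edf_queue pop m A s 0 = {}"
| "edf_queue pop m A s (Suc n) =
     (let Q = edf_queue pop m A s n \<union> A (s + int n) in Q - popped pop (m (s + int n)) Q)"

definition edf_scheduled ::
  "(job set \<Rightarrow> job) \<Rightarrow> (int \<Rightarrow> nat) \<Rightarrow> (int \<Rightarrow> job set) \<Rightarrow> int \<Rightarrow> int \<Rightarrow> job set" where
  "edf_scheduled pop m A s \<tau> = popped pop (m \<tau>) (edf_queue pop m A s (nat (\<tau> - s)) \<union> A \<tau>)"

text \<open>
  In the virtual schedule at time \<open>t\<close> all jobs of \<open>Q\<close> are available from \<open>t\<close> on and no further
  jobs arrive. The slots considered are those at times \<open>t, \<dots>, t + lam + T\<close>, so the last one ends
  at \<open>t + lam + T + 1\<close>.
\<close>

definition needs_round ::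
  "int \<Rightarrow> int \<Rightarrow> (job set \<Rightarrow> job) \<Rightarrow> int \<Rightarrow> job set \<Rightarrow> int multiset \<Rightarrow> bool" where
  "needs_round lam T pop t Q I \<longleftrightarrow>
     (\<exists>j\<in>Q. deadline j \<le> t + lam + T + 1 \<and>
        \<not> (\<exists>\<tau>\<in>{t..t + lam + T}. feasible_at j \<tau> \<and>
             j \<in> edf_scheduled pop (slots lam T I) (\<lambda>u. if u = t then Q else {}) t \<tau>))"

definition calibration_round :: "real \<Rightarrow> int \<Rightarrow> int \<Rightarrow> int multiset" where
  "calibration_round \<alpha> T t = replicate_mset (nat \<lceil>1 / \<alpha>\<rceil>) t + {#t + T#}"

type_synonym state = "int multiset \<times> job set \<times> (job \<rightharpoonup> int)"

definition alg_step ::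
  "real \<Rightarrow> int \<Rightarrow> int \<Rightarrow> (job set \<Rightarrow> job) \<Rightarrow> job set \<Rightarrow> int \<Rightarrow> state \<Rightarrow> state option" where
  "alg_step \<alpha> lam T pop J t = (\<lambda>(I, Q, S).
     let Q' = Q \<union> {j \<in> J. release j = t} in
     map_option
       (\<lambda>I'. let P = popped pop (slots lam T I' t) Q' in
          (I', Q' - P, \<lambda>j. if j \<in> P then Some t else S j))
       (while_option (needs_round lam T pop t Q') (\<lambda>I'. I' + calibration_round \<alpha> T t) I))"

text \<open>
  The state after the first \<open>n\<close> time steps, counted from the first release time: before that the
  queue is empty and a step changes nothing.
\<close>

fun alg_run ::
  "real \<Rightarrow> int \<Rightarrow> int \<Rightarrow> (job set \<Rightarrow> job) \<Rightarrow> job set \<Rightarrow> nat \<Rightarrow> state option" where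
  "alg_run \<alpha> lam T pop J 0 = Some ({#}, {}, Map.empty)"
| "alg_run \<alpha> lam T pop J (Suc n) =
     Option.bind (alg_run \<alpha> lam T pop J n) (alg_step \<alpha> lam T pop J (Min (release ` J) + int n))"

definition final_state ::
  "real \<Rightarrow> int \<Rightarrow> int \<Rightarrow> (job set \<Rightarrow> job) \<Rightarrow> job set \<Rightarrow> state \<Rightarrow> bool" where
  "final_state \<alpha> lam T pop J st \<longleftrightarrow> (\<forall>\<^sub>F n in sequentially. alg_run \<alpha> lam T pop J n = Some st)"

definition algorithm1 ::
  "real \<Rightarrow> int \<Rightarrow> int \<Rightarrow> (job set \<Rightarrow> job) \<Rightarrow> job set \<Rightarrow> (int multiset \<times> (job \<rightharpoonup> int)) option" where
  "algorithm1 \<alpha> lam T pop J =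
     (if \<exists>st. final_state \<alpha> lam T pop J st
      then case (THE st. final_state \<alpha> lam T pop J st) of (I, Q, S) \<Rightarrow> Some (I, S)
      else None)"

end

theory Submission imports Defs begin

text \<open>
  Let \<open>L = \<lceil>\<alpha> T\<rceil>\<close> and \<open>k = \<lceil>1/\<alpha>\<rceil>\<close>, so that \<open>k L \<ge> T\<close>. Under EDF only the numbers of jobs due by each
  \<open>d\<close> and of slots before \<open>d\<close> matter. A round is made at time \<open>t\<close> because too many jobs are due by
  some \<open>d \<le> t + lam + T + 1\<close>. New jobs are due no earlier than \<open>t + lam + L\<close>, and the jobs due
  before that were already accommodated at time \<open>t - 1\<close>; hence \<open>d \<ge> t + lam + L\<close>. Going back to the
  start \<open>a\<close> of the busy period, the jobs released from \<open>a\<close> on and due by \<open>d\<close> outnumber the slots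
  of the algorithm in \<open>[a, d)\<close>.

  Every round, made at time \<open>s\<close>, is charged to its own calibration of the optimum, starting at
  some \<open>u \<le> s + T\<close>. A round offers at least as many slots in \<open>[a, d)\<close> as the calibration it is
  charged to. Therefore the overload of \<open>[a, d)\<close> forces the optimum to have a further calibration
  with a slot before \<open>d\<close>, hence starting by \<open>t + T\<close>, and the new round is charged to that one. So
  there are at most as many rounds as calibrations in the optimum.
\<close>

section \<open>Counting calibrated slots\<close>

definition slot_count :: "int \<Rightarrow> int \<Rightarrow> int multiset \<Rightarrow> int \<Rightarrow> int \<Rightarrow> nat" where
  "slot_count lam T I a b = (\<Sum>\<tau>\<in>{a..<b}. slots lam T I \<tau>)"

lemma slots_plus: "slots lam T (I + I') \<tau> = slots lam T I \<tau> + slots lam T I' \<tau>"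
  by (simp add: slots_def)

lemma slots_mono: "I \<subseteq># I' \<Longrightarrow> slots lam T I \<tau> \<le> slots lam T I' \<tau>"
  by (auto simp: slots_plus dest!: mset_subset_eq_exists_conv[THEN iffD1])

lemma slot_count_plus:
  "slot_count lam T (I + I') a b = slot_count lam T I a b + slot_count lam T I' a b"
  by (simp add: slot_count_def slots_plus sum.distrib)

lemma slot_count_empty [simp]: "slot_count lam T {#} a b = 0"
  by (simp add: slot_count_def slots_def)

lemma slot_count_single:
  "slot_count lam T {#s#} a b = card (calibrated lam T s \<inter> {a..<b})"
proof -
  have "slot_count lam T {#s#} a b = (\<Sum>\<tau>\<in>{a..<b}. if \<tau> \<in> calibrated lam T s then 1 else 0)"
    unfolding slot_count_def by (intro sum.cong) (auto simp: slots_def)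
  also have "\<dots> = card ({a..<b} \<inter> calibrated lam T s)"
    by (subst sum.inter_restrict [symmetric]) simp_all
  finally show ?thesis by (simp add: Int_commute)
qed

lemma slot_count_replicate_mset:
  "slot_count lam T (replicate_mset k s) a b = k * slot_count lam T {#s#} a b"
proof (induction k)
  case (Suc k)
  have "replicate_mset (Suc k) s = {#s#} + replicate_mset k s" by simp
  then show ?case using Suc by (simp only: slot_count_plus) simp
qed simp

lemma slot_count_split:
  "a \<le> b \<Longrightarrow> b \<le> c \<Longrightarrow> slot_count lam T I a c = slot_count lam T I a b + slot_count lam T I b c"
  unfolding slot_count_def
  by (subst sum.union_disjoint [symmetric]) (auto simp: ivl_disj_un_two)

lemma slot_count_Suc:
  "t < b \<Longrightarrow> slot_count lam T I t b = slots lam T I t + slot_count lam T I (t + 1) b"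
proof -
  assume "t < b"
  then have "{t..<b} = insert t {t + 1..<b}" by auto
  then show ?thesis by (simp add: slot_count_def)
qed

lemma slot_count_offsets:
  "(\<Sum>i<nat (d - t). slots lam T I (t + int i)) = slot_count lam T I t d"
  unfolding slot_count_def
  by (rule sum.reindex_bij_witness[of _ "\<lambda>\<tau>. nat (\<tau> - t)" "\<lambda>i. t + int i"]) auto

section \<open>Feasible solutions as counting conditions\<close>

text \<open>Jobs processed at the same time sit on different machines, so sending each to its pair
  of machine and serving calibration is injective into the pairs of \<open>C\<close> calibrated at
  that time.\<close>

lemma feasible_solution_load_le_slots:
  assumes "feasible_solution lam T J I S" and "finite J"
  shows "card {j \<in> J. the (S j) = \<tau>} \<le> slots lam T I \<tau>"
proof -
  obtain C :: "(nat \<times> int) set" and M where C: "finite C" "image_mset snd (mset_set C) = I"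
    and cal: "\<forall>j\<in>J. feasible_at j (the (S j)) \<and>
           (\<exists>s. (M j, s) \<in> C \<and> the (S j) \<in> calibrated lam T s)"
    and inj: "inj_on (\<lambda>j. (M j, the (S j))) J"
    using assms(1) unfolding feasible_solution_def by blast
  obtain c where c: "\<And>j. j \<in> J \<Longrightarrow> (M j, c j) \<in> C \<and> the (S j) \<in> calibrated lam T (c j)"
    using bchoice[of J "\<lambda>j s. (M j, s) \<in> C \<and> the (S j) \<in> calibrated lam T s"] cal by blast
  let ?A = "{j \<in> J. the (S j) = \<tau>}" and ?B = "{p \<in> C. \<tau> \<in> calibrated lam T (snd p)}"
  have "inj_on (\<lambda>j. (M j, c j)) ?A"
    using inj by (auto simp: inj_on_def)
  moreover have "(\<lambda>j. (M j, c j)) ` ?A \<subseteq> ?B" using c by auto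
  ultimately have "card ?A \<le> card ?B" using C(1) by (intro card_inj_on_le) auto
  also have "card ?B = slots lam T I \<tau>"
    unfolding slots_def C(2)[symmetric] using C(1) by (simp add: filter_mset_image_mset)
  finally show ?thesis .
qed

text \<open>A job with its whole window inside \<open>[a, b)\<close> runs at a time of
  \<open>[a, b)\<close>; summing the loads gives the bound. This is the only property of an optimum
  that the charging uses.\<close>

lemma feasible_solution_demand_le_slot_count:
  assumes "feasible_solution lam T J I S" and "finite J"
  shows "card {j \<in> J. a \<le> release j \<and> deadline j \<le> b} \<le> slot_count lam T I a b"
proof -
  have f: "feasible_at j (the (S j))" if "j \<in> J" for j
    using assms(1) that unfolding feasible_solution_def by blast
  have "{j \<in> J. a \<le> release j \<and> deadline j \<le> b} \<subseteq> (\<Union>\<tau>\<in>{a..<b}. {j \<in> J. the (S j) = \<tau>})"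
    using f by (fastforce simp: feasible_at_def)
  then have "card {j \<in> J. a \<le> release j \<and> deadline j \<le> b}
      \<le> card (\<Union>\<tau>\<in>{a..<b}. {j \<in> J. the (S j) = \<tau>})"
    using assms(2) by (intro card_mono) auto
  also have "\<dots> \<le> (\<Sum>\<tau>\<in>{a..<b}. card {j \<in> J. the (S j) = \<tau>})"
    by (rule card_UN_le) simp
  also have "\<dots> \<le> slot_count lam T I a b"
    unfolding slot_count_def by (intro sum_mono feasible_solution_load_le_slots assms)
  finally show ?thesis .
qed

text \<open>Each calibration is given a machine of its own.\<close>

lemma feasible_solutionI:
  assumes "finite J" and "dom S = J"
    and feas: "\<And>j. j \<in> J \<Longrightarrow> feasible_at j (the (S j))"
    and load: "\<And>\<tau>. card {j \<in> J. S j = Some \<tau>} \<le> slots lam T I \<tau>"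
  shows "feasible_solution lam T J I S"
proof -
  obtain xs where xs: "mset xs = I" using ex_mset by blast
  \<comment> \<open>Machines are positions in \<open>xs\<close>: equal starting times stay separate,
    and no machine carries two calibrations that could overlap.\<close>
  define C where "C = (\<lambda>i. (i, xs ! i)) ` {..<length xs}"
  define B where "B \<tau> = {i \<in> {..<length xs}. \<tau> \<in> calibrated lam T (xs ! i)}" for \<tau>
  have C_I: "image_mset snd (mset_set C) = I"
  proof -
    have "mset_set C = image_mset (\<lambda>i. (i, xs ! i)) (mset_set {..<length xs})"
      unfolding C_def by (rule image_mset_mset_set[symmetric]) (auto simp: inj_on_def)
    then have "image_mset snd (mset_set C) = image_mset ((!) xs) (mset_set {..<length xs})"
      by (simp add: image_mset.compositionality o_def)
    also have "\<dots> = mset (map ((!) xs) [0..<length xs])"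
      by (metis atLeast_upt mset_map mset_set_upto_eq_mset_upto lessThan_atLeast0)
    finally show ?thesis using xs by (simp add: map_nth)
  qed
  have "slots lam T I \<tau> = card (B \<tau>)" for \<tau>
    unfolding slots_def xs[symmetric] B_def
    by (simp add: mset_filter[symmetric] length_filter_conv_card del: mset_filter)
  then have "\<exists>f. f ` {j \<in> J. S j = Some \<tau>} \<subseteq> B \<tau> \<and> inj_on f {j \<in> J. S j = Some \<tau>}" for \<tau>
    using load[of \<tau>] assms(1) by (intro card_le_inj) (auto simp: B_def)
  then obtain f where f: "\<And>\<tau>. f \<tau> ` {j \<in> J. S j = Some \<tau>} \<subseteq> B \<tau>"
      "\<And>\<tau>. inj_on (f \<tau>) {j \<in> J. S j = Some \<tau>}"
    by metis
  define M where "M j = f (the (S j)) j" for j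
  have S: "S j = Some (the (S j))" if "j \<in> J" for j
    using that assms(2) by auto
  have "M j \<in> B (the (S j))" if "j \<in> J" for j
    using f(1)[of "the (S j)"] that S[OF that] by (auto simp: M_def)
  then have "\<exists>s. (M j, s) \<in> C \<and> the (S j) \<in> calibrated lam T s" if "j \<in> J" for j
    using that by (fastforce simp: B_def C_def)
  moreover have "inj_on (\<lambda>j. (M j, the (S j))) J"
  proof (rule inj_onI)
    fix i j assume ij: "i \<in> J" "j \<in> J" "(M i, the (S i)) = (M j, the (S j))"
    then show "i = j"
      using f(2)[of "the (S j)"] S[of i] S[of j] by (auto simp: M_def inj_on_def)
  qed
  moreover have "finite C" and "\<forall>m s s'. (m, s) \<in> C \<and> (m, s') \<in> C \<and> s \<noteq> s' \<longrightarrow>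
           occupied lam T s \<inter> occupied lam T s' = {}"
    by (auto simp: C_def)
  ultimately show ?thesis
    unfolding feasible_solution_def using assms(2) feas C_I
    by (intro conjI exI[of _ C] exI[of _ M] ballI) simp_all
qed

section \<open>Earliest deadline first as a counting process\<close>

definition due :: "job set \<Rightarrow> int \<Rightarrow> job set" where
  "due Q d = {j \<in> Q. deadline j \<le> d}"

lemma finite_due [simp]: "finite Q \<Longrightarrow> finite (due Q d)"
  by (simp add: due_def)

lemma popped_subset:
  "smallest_deadline_rule pop \<Longrightarrow> finite Q \<Longrightarrow> popped pop m Q \<subseteq> Q"
proof (induction m arbitrary: Q)
  case (Suc m)
  then show ?case
    using Suc.IH[of "Q - {pop Q}"] by (auto simp: smallest_deadline_rule_def)
qed simp

lemma card_popped_le: "card (popped pop m Q) \<le> m"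
proof (induction m arbitrary: Q)
  case (Suc m)
  show ?case
    using Suc.IH[of "Q - {pop Q}"] by (auto intro: card_insert_le_m1)
qed simp

text \<open>As long as some job is due by \<open>d\<close>, a job of smallest deadline is one of
  them, so each pop lowers the count by one until it reaches 0; hence the truncated subtraction. Tie
  breaking has no effect on the count.\<close>

lemma card_due_diff_popped:
  assumes "smallest_deadline_rule pop" and "finite Q"
  shows "card (due (Q - popped pop m Q) d) = card (due Q d) - m"
  using assms(2)
proof (induction m arbitrary: Q)
  case (Suc m)
  show ?case
  proof (cases "Q = {}")
    case False
    define p where "p = pop Q"
    have p: "p \<in> Q" "\<And>q. q \<in> Q \<Longrightarrow> deadline p \<le> deadline q"
      using assms(1) Suc.prems False by (auto simp: smallest_deadline_rule_def p_def)
    have "Q - popped pop (Suc m) Q = (Q - {p}) - popped pop m (Q - {p})"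
      using False by (auto simp: p_def)
    then have "card (due (Q - popped pop (Suc m) Q) d) = card (due (Q - {p}) d) - m"
      using Suc by simp
    also have "card (due (Q - {p}) d) = card (due Q d) - 1"
    proof (cases "deadline p \<le> d")
      case True
      then have "due (Q - {p}) d = due Q d - {p}" "p \<in> due Q d"
        using p by (auto simp: due_def)
      then show ?thesis by simp
    next
      case False
      then have "due Q d = {}" "due (Q - {p}) d = {}" using p by (fastforce simp: due_def)+
      then show ?thesis by simp
    qed
    finally show ?thesis by simp
  qed (simp add: due_def)
qed simp

text \<open>A job that virtual EDF misses is still queued at its deadline \<open>d\<close>, so the
  slots before \<open>d\<close> did not suffice for the jobs due by \<open>d\<close>. Conversely, an
  overload leaves some job due by \<open>d\<close> in the queue at \<open>d\<close>, and that job is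
  never popped in time. For \<open>d \<le> t\<close> there are no slots, so overload then means an
  overdue job.\<close>

lemma needs_round_iff:
  assumes pop: "smallest_deadline_rule pop" and fin: "finite Q"
    and rel: "\<And>j. j \<in> Q \<Longrightarrow> release j \<le> t"
  shows "needs_round lam T pop t Q I \<longleftrightarrow>
    (\<exists>d \<le> t + lam + T + 1. slot_count lam T I t d < card (due Q d))"
proof -
  define A where "A = (\<lambda>u. if u = t then Q else {})"
  define m where "m = slots lam T I"
  define E where "E k = edf_queue pop m A t k \<union> A (t + int k)" for k
  have E_0: "E 0 = Q" by (simp add: E_def A_def)
  have E_Suc: "E (Suc k) = E k - popped pop (m (t + int k)) (E k)" for k
    by (simp add: E_def A_def Let_def)
  have fin_E: "finite (E k)" for k
    by (induction k) (simp_all add: E_0 E_Suc fin)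
  have scheduled: "edf_scheduled pop m A t \<tau> = popped pop (m \<tau>) (E (nat (\<tau> - t)))" if "t \<le> \<tau>" for \<tau>
    using that by (simp add: edf_scheduled_def E_def)
  have anti: "E k' \<subseteq> E k" if "k \<le> k'" for k k'
    using that by (induction rule: dec_induct) (auto simp: E_Suc)
  have "card (due (E k) d) = card (due Q d) - (\<Sum>i<k. m (t + int i))" for k d
    by (induction k) (simp_all add: E_0 E_Suc card_due_diff_popped[OF pop fin_E])
  then have card_E: "card (due (E (nat (d - t))) d) = card (due Q d) - slot_count lam T I t d" for d
    by (simp add: m_def slot_count_offsets)
  have overload: "slot_count lam T I t d < card (due Q d) \<longleftrightarrow> due (E (nat (d - t))) d \<noteq> {}" for d
    using card_E[of d] fin_E[of "nat (d - t)"] card_0_eq[of "due (E (nat (d - t))) d"] by force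
  \<comment> \<open>Jobs of \<open>Q\<close> are already released, and the deadline bound keeps
    their feasible times within the horizon, so these are exactly
    \<open>t, ..., deadline j - 1\<close>.\<close>
  have needs: "needs_round lam T pop t Q I \<longleftrightarrow>
      (\<exists>j\<in>Q. deadline j \<le> t + lam + T + 1 \<and>
        (\<forall>\<tau>\<in>{t..<deadline j}. j \<notin> popped pop (m \<tau>) (E (nat (\<tau> - t)))))"
    unfolding needs_round_def m_def[symmetric] A_def[symmetric]
    using rel by (fastforce simp: scheduled feasible_at_def)
  show ?thesis
  proof
    assume "needs_round lam T pop t Q I"
    then obtain j where j: "j \<in> Q" "deadline j \<le> t + lam + T + 1"
      and un: "\<And>\<tau>. \<tau> \<in> {t..<deadline j} \<Longrightarrow> j \<notin> popped pop (m \<tau>) (E (nat (\<tau> - t)))"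
      unfolding needs by blast
    have "j \<in> E k" if "k \<le> nat (deadline j - t)" for k
      using that
    proof (induction k)
      case (Suc k)
      then show ?case using un[of "t + int k"] by (auto simp: E_Suc)
    qed (simp add: E_0 j)
    then have "j \<in> due (E (nat (deadline j - t))) (deadline j)"
      by (simp add: due_def)
    then show "\<exists>d \<le> t + lam + T + 1. slot_count lam T I t d < card (due Q d)"
      using j overload by blast
  next
    assume "\<exists>d \<le> t + lam + T + 1. slot_count lam T I t d < card (due Q d)"
    then obtain d j where d: "d \<le> t + lam + T + 1"
      and j: "j \<in> E (nat (d - t))" "deadline j \<le> d"
      unfolding overload by (auto simp: due_def)
    have "j \<notin> popped pop (m \<tau>) (E (nat (\<tau> - t)))" if "\<tau> \<in> {t..<deadline j}" for \<tau>
    proof -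
      have "Suc (nat (\<tau> - t)) \<le> nat (d - t)"
        using that j(2) unfolding Suc_le_eq by (subst nat_less_eq_zless) auto
      then have "j \<in> E (Suc (nat (\<tau> - t)))" using anti j(1) by blast
      then show ?thesis using that by (simp add: E_Suc)
    qed
    moreover have "j \<in> Q" using anti[of 0] j by (auto simp: E_0)
    ultimately show "needs_round lam T pop t Q I"
      unfolding needs using d j by force
  qed
qed

section \<open>Charging rounds to calibrations of a feasible solution\<close>

lemma slot_count_pos_obtain:
  assumes "0 < slot_count lam T I a b"
  obtains s where "s \<in># I" and "s + lam < b"
proof -
  obtain \<tau> where \<tau>: "\<tau> \<in> {a..<b}" "slots lam T I \<tau> \<noteq> 0"
    using assms unfolding slot_count_def by (metis less_numeral_extra(3) sum.neutral)
  then obtain s where "s \<in># {#s \<in># I. \<tau> \<in> calibrated lam T s#}"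
    by (auto simp: slots_def size_eq_0_iff_empty)
  then show thesis using \<tau>(1) by (intro that[of s]) (auto simp: calibrated_def)
qed

locale long_window_instance =
  fixes \<alpha> :: real and lam T :: int and pop :: "job set \<Rightarrow> job" and J :: "job set"
  assumes \<alpha>_pos: "0 < \<alpha>" and \<alpha>_less_1: "\<alpha> < 1" and lam_nonneg: "0 \<le> lam" and T_pos: "0 < T"
    and pop: "smallest_deadline_rule pop"
    and finite_J: "finite J"
    and long: "j \<in> J \<Longrightarrow> long_window \<alpha> lam T j"
begin

definition k :: nat where "k = nat \<lceil>1 / \<alpha>\<rceil>"

definition L :: int where "L = \<lceil>\<alpha> * real_of_int T\<rceil>"

lemma k_pos: "1 \<le> k"
  using \<alpha>_pos by (simp add: k_def Suc_le_eq)

lemma L_pos: "1 \<le> L"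
  using \<alpha>_pos T_pos by (simp add: L_def int_one_le_iff_zero_less)

lemma L_le_T: "L \<le> T"
  using \<alpha>_less_1 T_pos by (simp add: L_def ceiling_le_iff)

lemma int_k: "int k = \<lceil>1 / \<alpha>\<rceil>"
proof -
  have "0 < \<lceil>1 / \<alpha>\<rceil>" using \<alpha>_pos by (simp only: zero_less_ceiling zero_less_divide_1_iff)
  then show ?thesis unfolding k_def by (simp only: nat_0_le less_imp_le)
qed

lemma T_le_k_mult_L: "T \<le> int k * L"
proof -
  have k: "1 / \<alpha> \<le> real k"
    using le_of_int_ceiling[of "1 / \<alpha>"] by (simp flip: int_k)
  have "real_of_int T = (1 / \<alpha>) * (\<alpha> * real_of_int T)" using \<alpha>_pos by simp
  also have "\<dots> \<le> real k * real_of_int L"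
    using k \<alpha>_pos T_pos by (intro mult_mono) (simp_all add: L_def)
  also have "\<dots> = real_of_int (int k * L)" by simp
  finally show ?thesis by linarith
qed

lemma release_plus_L_le_deadline:
  assumes "j \<in> J"
  shows "release j + lam + L \<le> deadline j"
proof -
  have "\<alpha> * real_of_int T \<le> real_of_int (deadline j - release j - lam)"
    using long[OF assms] by (simp add: long_window_def)
  then have "L \<le> deadline j - release j - lam" unfolding L_def by (rule ceiling_le)
  then show ?thesis by simp
qed

text \<open>
  The calibration at \<open>u\<close> may offer \<open>T\<close> slots in \<open>[a, d)\<close> before the round offers any, but then
  the \<open>k\<close> parallel calibrations offer \<open>k * L \<ge> T\<close> slots in \<open>[s + lam, s + lam + L)\<close>.
\<close>

lemma slot_count_le_round:
  assumes "u \<le> s + T" and "s + lam + L \<le> d"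
  shows "slot_count lam T {#u#} a d \<le> slot_count lam T (calibration_round \<alpha> T s) a d"
proof -
  let ?c = "\<lambda>s. card (calibrated lam T s \<inter> {a..<d})"
  have round: "slot_count lam T (calibration_round \<alpha> T s) a d = k * ?c s + ?c (s + T)"
    using slot_count_plus[of lam T "replicate_mset k s" "{#s + T#}" a d]
    by (simp add: calibration_round_def k_def slot_count_replicate_mset slot_count_single)
  have "?c u \<le> k * ?c s + ?c (s + T)"
  proof (cases "a \<le> s + lam")
    case True
    have "{s + lam..<s + lam + L} \<subseteq> calibrated lam T s \<inter> {a..<d}"
      using True assms(2) L_le_T by (auto simp: calibrated_def)
    then have "card {s + lam..<s + lam + L} \<le> ?c s" by (intro card_mono) auto
    then have "L \<le> int (?c s)" using L_pos by simp
    then have "int k * L \<le> int k * int (?c s)" by (intro mult_left_mono) auto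
    moreover have "?c u \<le> card (calibrated lam T u)"
      by (intro card_mono) (auto simp: calibrated_def)
    moreover have "int (card (calibrated lam T u)) = T"
      using T_pos by (simp add: calibrated_def)
    ultimately have "int (?c u) \<le> int (k * ?c s)"
      unfolding of_nat_mult using T_le_k_mult_L by linarith
    then show ?thesis by linarith
  next
    case False
    \<comment> \<open>Here the calibrations at \<open>s\<close> and \<open>s + T\<close> together
      cover \<open>[s + lam, s + lam + 2 * T)\<close>, which contains every slot of \<open>u\<close>
      from \<open>a\<close> on. This is the purpose of the second starting time.\<close>
    have "calibrated lam T u \<inter> {a..<d}
        \<subseteq> (calibrated lam T s \<inter> {a..<d}) \<union> (calibrated lam T (s + T) \<inter> {a..<d})"
      using False assms(1) by (auto simp: calibrated_def)
    then have "?c u \<le> card ((calibrated lam T s \<inter> {a..<d}) \<union> (calibrated lam T (s + T) \<inter> {a..<d}))"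
      by (intro card_mono) auto
    also have "\<dots> \<le> ?c s + ?c (s + T)" by (rule card_Un_le)
    also have "?c s \<le> k * ?c s" using k_pos by simp
    finally show ?thesis by simp
  qed
  then show ?thesis by (simp add: round slot_count_single)
qed

section \<open>The charging relation between rounds and calibrations\<close>

definition rounds :: "int multiset \<Rightarrow> int multiset" where
  "rounds R = (\<Sum>s\<in>#R. calibration_round \<alpha> T s)"

lemma rounds_add_mset: "rounds (add_mset s R) = rounds R + calibration_round \<alpha> T s"
  by (simp add: rounds_def add.commute)

lemma size_rounds: "size (rounds R) = (k + 1) * size R"
  by (induction R) (simp_all add: rounds_def calibration_round_def k_def)

lemma slot_count_le_rounds:
  assumes "rel_mset (\<lambda>s u. u \<le> s + T) R U" and "\<forall>s\<in>#R. s + lam + L \<le> d"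
  shows "slot_count lam T U a d \<le> slot_count lam T (rounds R) a d"
  using assms
proof (induction "\<lambda>s u. u \<le> s + T" R U rule: rel_mset_induct)
  case (add s u R U)
  have "slot_count lam T (add_mset u U) a d = slot_count lam T U a d + slot_count lam T {#u#} a d"
    using slot_count_plus[of lam T U "{#u#}"] by simp
  then show ?case
    using add slot_count_le_round[of u s d a] by (simp add: rounds_add_mset slot_count_plus)
qed simp

text \<open>Quantifying over all feasible solutions avoids fixing an optimum.
  \<open>rel_mset\<close> is a perfect matching of multisets, and the inclusion of \<open>U\<close>
  in \<open>I'\<close> ensures that no calibration is charged twice.\<close>

definition charged :: "int \<Rightarrow> int multiset \<Rightarrow> bool" where
  "charged t I \<longleftrightarrow> (\<exists>R. I = rounds R \<and> (\<forall>s\<in>#R. s \<le> t) \<and>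
     (\<forall>I' S'. feasible_solution lam T J I' S' \<longrightarrow>
        (\<exists>U. U \<subseteq># I' \<and> rel_mset (\<lambda>s u. u \<le> s + T) R U)))"

lemma charged_empty: "charged t {#}"
  unfolding charged_def
  by (rule exI[of _ "{#}"]) (auto simp: rounds_def rel_mset_Zero)

lemma charged_mono: "charged t I \<Longrightarrow> t \<le> t' \<Longrightarrow> charged t' I"
  unfolding charged_def by (elim exE, rule exI) (auto intro: order_trans)

lemma charged_size_le:
  assumes "charged t I" and "feasible_solution lam T J I' S'"
  shows "size I \<le> (k + 1) * size I'"
proof -
  obtain R U where RU: "I = rounds R" "U \<subseteq># I'" "rel_mset (\<lambda>s u. u \<le> s + T) R U"
    using assms unfolding charged_def by blast
  then have "size R \<le> size I'"
    using rel_mset_size size_mset_mono by metis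
  then have "(k + 1) * size R \<le> (k + 1) * size I'" by (rule mult_le_mono2)
  then show ?thesis using RU(1) by (simp only: size_rounds)
qed

text \<open>
  On the overloaded interval \<open>[a, d)\<close> a feasible solution has more slots than the rounds made so
  far, hence more than its calibrations charged so far; so one more of its calibrations, not yet
  charged, offers a slot before \<open>d\<close>.
\<close>

lemma charged_add_round:
  assumes "charged t I"
    and overload: "slot_count lam T I a d < card {j \<in> J. a \<le> release j \<and> deadline j \<le> d}"
    and d: "t + lam + L \<le> d" "d \<le> t + lam + T + 1"
  shows "charged t (I + calibration_round \<alpha> T t)"
proof -
  obtain R where R: "I = rounds R" "\<forall>s\<in>#R. s \<le> t"
    and ch: "\<And>I' S'. feasible_solution lam T J I' S' \<Longrightarrow>
        \<exists>U. U \<subseteq># I' \<and> rel_mset (\<lambda>s u. u \<le> s + T) R U"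
    using assms(1) unfolding charged_def by blast
  have "\<exists>U. U \<subseteq># I' \<and> rel_mset (\<lambda>s u. u \<le> s + T) (add_mset t R) U"
    if feas: "feasible_solution lam T J I' S'" for I' S'
  proof -
    obtain U where U: "U \<subseteq># I'" "rel_mset (\<lambda>s u. u \<le> s + T) R U" using ch feas by blast
    then obtain V where V: "I' = U + V" by (auto simp: mset_subset_eq_exists_conv)
    have "slot_count lam T U a d \<le> slot_count lam T I a d"
      unfolding R(1) using U(2) R(2) d(1) by (intro slot_count_le_rounds) fastforce+
    also note overload
    also have "card {j \<in> J. a \<le> release j \<and> deadline j \<le> d} \<le> slot_count lam T I' a d"
      using feasible_solution_demand_le_slot_count[OF feas finite_J] .
    finally have "0 < slot_count lam T V a d" by (simp add: V slot_count_plus)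
    then obtain u where u: "u \<in># V" "u + lam < d" by (rule slot_count_pos_obtain)
    have "add_mset u U \<subseteq># I'" using u(1) by (auto simp: V dest!: multi_member_split)
    \<comment> \<open>From \<open>u + lam < d \<le> t + lam + T + 1\<close> follows
      \<open>u \<le> t + T\<close>: the test horizon is as long as the charge permits.\<close>
    moreover have "rel_mset (\<lambda>s u. u \<le> s + T) (add_mset t R) (add_mset u U)"
      using u(2) d(2) U(2) by (intro rel_mset_Plus) auto
    ultimately show ?thesis by blast
  qed
  then show ?thesis
    unfolding charged_def using R by (intro exI[of _ "add_mset t R"]) (auto simp: rounds_add_mset)
qed

section \<open>The invariant of the algorithm\<close>

text \<open>
  \<open>Q\<close> is the queue at time \<open>t\<close>, containing jobs released before \<open>b\<close>. The witness \<open>a\<close> is the start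
  of the busy period of \<open>d\<close>: from \<open>a\<close> to \<open>t\<close> all slots were used by jobs released since \<open>a\<close> and
  due by \<open>d\<close>.
\<close>

definition busy :: "int \<Rightarrow> int \<Rightarrow> int multiset \<Rightarrow> job set \<Rightarrow> bool" where
  "busy t b I Q \<longleftrightarrow> (\<forall>d. \<exists>a\<le>t. slot_count lam T I a t + card (due Q d)
     \<le> card {j \<in> J. a \<le> release j \<and> release j < b \<and> deadline j \<le> d})"

text \<open>The horizon \<open>t + lam + T\<close> is the one of the test made a step earlier,
  \<open>(t - 1) + lam + T + 1\<close>. The last three clauses become feasibility of the final
  schedule.\<close>

definition invar :: "int \<Rightarrow> state \<Rightarrow> bool" where
  "invar t = (\<lambda>(I, Q, S). charged t I \<and> busy t t I Q \<and>
     (\<forall>d \<le> t + lam + T. card (due Q d) \<le> slot_count lam T I t d) \<and>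
     Q \<subseteq> {j \<in> J. release j < t} \<and> dom S = {j \<in> J. release j < t} - Q \<and>
     (\<forall>j \<tau>. S j = Some \<tau> \<longrightarrow> feasible_at j \<tau> \<and> \<tau> < t) \<and>
     (\<forall>\<tau>. card {j \<in> J. S j = Some \<tau>} \<le> slots lam T I \<tau>))"

lemma slot_count_round_before: "slot_count lam T (calibration_round \<alpha> T t) a t = 0"
proof (rule ccontr)
  assume "slot_count lam T (calibration_round \<alpha> T t) a t \<noteq> 0"
  then obtain s where "s \<in># calibration_round \<alpha> T t" "s + lam < t"
    using slot_count_pos_obtain by blast
  then show False using lam_nonneg T_pos by (auto simp: calibration_round_def split: if_splits)
qed

text \<open>Progress for the while loop: every round adds a slot at the fixed time
  \<open>t + lam\<close>.\<close>

lemma slots_round_pos: "0 < slots lam T (calibration_round \<alpha> T t) (t + lam)"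
proof -
  have "t \<in># {#s \<in># calibration_round \<alpha> T t. t + lam \<in> calibrated lam T s#}"
    using k_pos T_pos by (auto simp: calibration_round_def calibrated_def k_def)
  then show ?thesis unfolding slots_def by (metis nonempty_has_size empty_not_add_mset multi_member_split)
qed

text \<open>The same \<open>a\<close> works: each arrival due by \<open>d\<close> has release time
  \<open>t \<ge> a\<close> and so counts on both sides.\<close>

lemma busy_arrivals:
  assumes "busy t t I Q" and "finite Q"
  shows "busy t (t + 1) I (Q \<union> {j \<in> J. release j = t})"
  unfolding busy_def
proof
  fix d
  let ?A = "{j \<in> J. release j = t}"
  obtain a where a: "a \<le> t" "slot_count lam T I a t + card (due Q d)
      \<le> card {j \<in> J. a \<le> release j \<and> release j < t \<and> deadline j \<le> d}"
    using assms(1) unfolding busy_def by blast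
  have "due (Q \<union> ?A) d = due Q d \<union> due ?A d" by (auto simp: due_def)
  then have "card (due (Q \<union> ?A) d) \<le> card (due Q d) + card (due ?A d)"
    by (simp add: card_Un_le)
  moreover have "{j \<in> J. a \<le> release j \<and> release j < t + 1 \<and> deadline j \<le> d} =
      {j \<in> J. a \<le> release j \<and> release j < t \<and> deadline j \<le> d} \<union> due ?A d"
    using a(1) by (auto simp: due_def)
  then have "card {j \<in> J. a \<le> release j \<and> release j < t + 1 \<and> deadline j \<le> d} =
      card {j \<in> J. a \<le> release j \<and> release j < t \<and> deadline j \<le> d} + card (due ?A d)"
    using finite_J by (simp only:) (rule card_Un_disjoint, auto simp: due_def)
  ultimately show "\<exists>a\<le>t. slot_count lam T I a t + card (due (Q \<union> ?A) d)
      \<le> card {j \<in> J. a \<le> release j \<and> release j < t + 1 \<and> deadline j \<le> d}"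
    using a by (intro exI[of _ a]) linarith
qed

text \<open>If at least \<open>?m\<close> jobs are due by \<open>d\<close>, all slots at
  \<open>t\<close> go to such jobs and the busy period continues with the same \<open>a\<close>.
  Otherwise none of them is left, and \<open>a = t + 1\<close> starts an empty period.\<close>

lemma busy_pop:
  assumes "busy t (t + 1) I Q" and "finite Q"
  shows "busy (t + 1) (t + 1) I (Q - popped pop (slots lam T I t) Q)"
  unfolding busy_def
proof
  fix d
  let ?m = "slots lam T I t"
  obtain a where a: "a \<le> t" "slot_count lam T I a t + card (due Q d)
      \<le> card {j \<in> J. a \<le> release j \<and> release j < t + 1 \<and> deadline j \<le> d}"
    using assms(1) unfolding busy_def by blast
  have m: "slot_count lam T I a (t + 1) = slot_count lam T I a t + ?m"
    using a(1) slot_count_split[of a t "t + 1"] slot_count_Suc[of t "t + 1"]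
    by (simp add: slot_count_def)
  note pops = card_due_diff_popped[OF pop assms(2), of ?m d]
  show "\<exists>a\<le>t + 1. slot_count lam T I a (t + 1) + card (due (Q - popped pop ?m Q) d)
      \<le> card {j \<in> J. a \<le> release j \<and> release j < t + 1 \<and> deadline j \<le> d}"
  proof (cases "?m \<le> card (due Q d)")
    case True
    then show ?thesis using a m pops by (intro exI[of _ a]) linarith
  next
    case False
    then show ?thesis using pops by (intro exI[of _ "t + 1"]) (simp add: slot_count_def)
  qed
qed

lemma alg_step_invar:
  assumes "invar t (I, Q, S)"
  shows "\<exists>st. alg_step \<alpha> lam T pop J t (I, Q, S) = Some st \<and> invar (t + 1) st"
proof -
  define A where "A = {j \<in> J. release j = t}"
  define Q' where "Q' = Q \<union> A"
  let ?add = "\<lambda>I'. I' + calibration_round \<alpha> T t"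
  have inv: "charged t I" "busy t t I Q"
    "\<And>d. d \<le> t + lam + T \<Longrightarrow> card (due Q d) \<le> slot_count lam T I t d"
    "Q \<subseteq> {j \<in> J. release j < t}" "dom S = {j \<in> J. release j < t} - Q"
    "\<And>j \<tau>. S j = Some \<tau> \<Longrightarrow> feasible_at j \<tau> \<and> \<tau> < t"
    "\<And>\<tau>. card {j \<in> J. S j = Some \<tau>} \<le> slots lam T I \<tau>"
    using assms by (auto simp: invar_def)
  have fin: "finite Q" using inv(4) finite_J by (auto intro: finite_subset)
  have fin': "finite Q'" using fin finite_J by (simp add: Q'_def A_def)
  have Q'_rel: "Q' \<subseteq> {j \<in> J. release j \<le> t}" using inv(4) by (auto simp: Q'_def A_def)
  have needs: "needs_round lam T pop t Q' I' \<longleftrightarrow>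
      (\<exists>d \<le> t + lam + T + 1. slot_count lam T I' t d < card (due Q' d))" for I'
    using Q'_rel by (intro needs_round_iff[OF pop fin']) auto
  \<comment> \<open>Loop invariant. Its bound below \<open>t + lam + L\<close> forces the
    \<open>d\<close> of any further round high enough for charging; \<open>I \<subseteq># I'\<close>
    preserves the slots already used.\<close>
  define P where "P I' \<longleftrightarrow> charged t I' \<and> busy t (t + 1) I' Q' \<and>
      (\<forall>d < t + lam + L. card (due Q' d) \<le> slot_count lam T I' t d) \<and> I \<subseteq># I'" for I'
  have P_I: "P I"
    unfolding P_def
  proof (intro conjI allI impI)
    show "busy t (t + 1) I Q'"
      unfolding Q'_def A_def using busy_arrivals[OF inv(2) fin] .
    fix d assume d: "d < t + lam + L"
    then have "due Q' d = due Q d"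
      using release_plus_L_le_deadline by (fastforce simp: due_def Q'_def A_def)
    then show "card (due Q' d) \<le> slot_count lam T I t d"
      using inv(3)[of d] d L_le_T by simp
  qed (simp_all add: inv(1))
  have P_add: "P (?add I') \<and> card Q' - slots lam T (?add I') (t + lam)
      < card Q' - slots lam T I' (t + lam)"
    if I': "P I'" and I'_needs: "needs_round lam T pop t Q' I'" for I'
  proof
    obtain d where d: "d \<le> t + lam + T + 1" "slot_count lam T I' t d < card (due Q' d)"
      using I'_needs needs by blast
    have d_ge: "t + lam + L \<le> d"
      using d(2) I' unfolding P_def by (meson not_less)
    obtain a where a: "a \<le> t" "slot_count lam T I' a t + card (due Q' d)
        \<le> card {j \<in> J. a \<le> release j \<and> release j < t + 1 \<and> deadline j \<le> d}"
      using I' unfolding P_def busy_def by blast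
    have "slot_count lam T I' a d = slot_count lam T I' a t + slot_count lam T I' t d"
      using a(1) d_ge L_pos lam_nonneg by (intro slot_count_split) auto
    also have "\<dots> < card {j \<in> J. a \<le> release j \<and> release j < t + 1 \<and> deadline j \<le> d}"
      using a(2) d(2) by linarith
    also have "\<dots> \<le> card {j \<in> J. a \<le> release j \<and> deadline j \<le> d}"
      using finite_J by (intro card_mono) auto
    finally have "charged t (?add I')"
      using I' d(1) d_ge by (intro charged_add_round) (auto simp: P_def)
    then show "P (?add I')"
      using I' unfolding P_def busy_def
      by (auto simp: slot_count_plus slot_count_round_before intro: trans_le_add1 subset_mset.trans)
    \<comment> \<open>Termination: \<open>t + lam\<close> lies in \<open>[t, d)\<close>, so under
      overload its slots number fewer than the jobs of \<open>Q'\<close>, and the truncated measure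
      strictly decreases.\<close>
    have "slots lam T I' (t + lam) \<le> slot_count lam T I' t d"
      unfolding slot_count_def using d_ge L_pos lam_nonneg by (intro member_le_sum) auto
    also have "\<dots> < card (due Q' d)" by (fact d(2))
    also have "\<dots> \<le> card Q'" using fin' by (intro card_mono) (auto simp: due_def)
    finally show "card Q' - slots lam T (?add I') (t + lam) < card Q' - slots lam T I' (t + lam)"
      using slots_round_pos[of t] by (simp add: slots_plus)
  qed
  obtain I' where while: "while_option (needs_round lam T pop t Q') ?add I = Some I'"
    using measure_while_option_Some[of P "needs_round lam T pop t Q'" ?add
        "\<lambda>I'. card Q' - slots lam T I' (t + lam)", OF P_add P_I] by blast
  have P_I': "P I'"
    using while_option_rule[of P, OF _ while P_I] P_add by blast
  have "\<not> needs_round lam T pop t Q' I'"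
    using while_option_stop[OF while] .
  then have virt: "card (due Q' d) \<le> slot_count lam T I' t d" if "d \<le> t + lam + T + 1" for d
    using that needs[of I'] by (meson not_less)
  define X where "X = popped pop (slots lam T I' t) Q'"
  define S' where "S' = (\<lambda>j. if j \<in> X then Some t else S j)"
  have X: "X \<subseteq> Q'" "card X \<le> slots lam T I' t"
    unfolding X_def using popped_subset[OF pop fin'] card_popped_le by auto
  \<comment> \<open>No slots lie in \<open>[t, d)\<close> for \<open>d \<le> t\<close>, so the
    passed test excludes overdue jobs; whatever is popped at \<open>t\<close> meets its
    deadline.\<close>
  have past: "due Q' d = {}" if "d \<le> t" for d
    using virt[of d] that lam_nonneg T_pos fin' by (simp add: slot_count_def)
  have "invar (t + 1) (I', Q' - X, S')"
    unfolding invar_def split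
  proof (intro conjI allI impI)
    show "charged (t + 1) I'" using P_I' by (auto simp: P_def intro: charged_mono)
    show "busy (t + 1) (t + 1) I' (Q' - X)"
      unfolding X_def using P_I' fin' by (intro busy_pop) (auto simp: P_def)
    show "Q' - X \<subseteq> {j \<in> J. release j < t + 1}" using Q'_rel by auto
    show "dom S' = {j \<in> J. release j < t + 1} - (Q' - X)"
    proof -
      have "dom S' = dom S \<union> X" by (auto simp: S'_def split: if_splits)
      then show ?thesis using inv(4,5) X(1) by (auto simp: Q'_def A_def)
    qed
  next
    fix d assume d: "d \<le> t + 1 + lam + T"
    have pops: "card (due (Q' - X) d) = card (due Q' d) - slots lam T I' t"
      unfolding X_def by (rule card_due_diff_popped[OF pop fin'])
    show "card (due (Q' - X) d) \<le> slot_count lam T I' (t + 1) d"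
    proof (cases "t < d")
      case True
      then show ?thesis using pops virt[of d] d slot_count_Suc[of t d lam T I'] by simp
    next
      case False
      then show ?thesis using pops past[of d] by simp
    qed
  next
    fix j \<tau> assume S': "S' j = Some \<tau>"
    have "feasible_at j t" if "j \<in> X"
    proof -
      have "j \<in> Q'" using that X(1) by auto
      then have "\<not> deadline j \<le> t" using past[of "deadline j"] by (auto simp: due_def)
      then show ?thesis using \<open>j \<in> Q'\<close> Q'_rel by (auto simp: feasible_at_def)
    qed
    then show "feasible_at j \<tau>" and "\<tau> < t + 1"
      using S' inv(6)[of j \<tau>] by (auto simp: S'_def split: if_splits)
  next
    fix \<tau>
    show "card {j \<in> J. S' j = Some \<tau>} \<le> slots lam T I' \<tau>"
    proof (cases "\<tau> = t")
      case True
      then have "{j \<in> J. S' j = Some \<tau>} \<subseteq> X"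
        using inv(6) by (auto simp: S'_def split: if_splits)
      then have "card {j \<in> J. S' j = Some \<tau>} \<le> card X"
        using X(1) fin' by (intro card_mono) (auto intro: finite_subset)
      then show ?thesis using X(2) True by simp
    next
      case False
      then have "{j \<in> J. S' j = Some \<tau>} \<subseteq> {j \<in> J. S j = Some \<tau>}"
        by (auto simp: S'_def split: if_splits)
      then have "card {j \<in> J. S' j = Some \<tau>} \<le> card {j \<in> J. S j = Some \<tau>}"
        using finite_J by (intro card_mono) auto
      also have "\<dots> \<le> slots lam T I \<tau>" by (fact inv(7))
      also have "\<dots> \<le> slots lam T I' \<tau>" using P_I' by (intro slots_mono) (simp add: P_def)
      finally show ?thesis .
    qed
  qed
  moreover have "alg_step \<alpha> lam T pop J t (I, Q, S) = Some (I', Q' - X, S')"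
    using while by (simp add: alg_step_def Q'_def A_def X_def S'_def Let_def)
  ultimately show ?thesis by blast
qed

section \<open>Runs of the algorithm and their final state\<close>

lemma alg_run_invar:
  "\<exists>st. alg_run \<alpha> lam T pop J n = Some st \<and> invar (Min (release ` J) + int n) st"
proof (induction n)
  case 0
  \<comment> \<open>For empty \<open>J\<close> the minimum is unspecified, but the invariant then
    holds at any starting time.\<close>
  have "\<not> release j < Min (release ` J)" if "j \<in> J" for j
    using that finite_J by (simp add: not_less)
  moreover have "busy t t {#} {}" for t by (auto simp: busy_def due_def)
  ultimately show ?case by (auto simp: invar_def charged_empty due_def)
next
  case (Suc n)
  then obtain st where st: "alg_run \<alpha> lam T pop J n = Some st"
    "invar (Min (release ` J) + int n) st" by blast
  obtain I Q S where "st = (I, Q, S)" by (cases st)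
  then show ?case using st alg_step_invar[of "Min (release ` J) + int n" I Q S]
    by (simp add: add.assoc add.commute[of 1])
qed

lemma alg_step_idle:
  assumes "{j \<in> J. release j = t} = {}"
  shows "alg_step \<alpha> lam T pop J t (I, {}, S) = Some (I, {}, S)"
proof -
  have "popped pop m {} = {}" for m by (cases m) simp_all
  moreover have "\<not> needs_round lam T pop t {} I" by (simp add: needs_round_def)
  ultimately show ?thesis
    unfolding alg_step_def by (simp add: assms while_option_unfold Let_def)
qed

lemma algorithm1_eqI:
  assumes "final_state \<alpha> lam T pop J (I, Q, S)"
  shows "algorithm1 \<alpha> lam T pop J = Some (I, S)"
proof -
  have "st = (I, Q, S)" if "final_state \<alpha> lam T pop J st" for st
  proof -
    have "\<forall>\<^sub>F n in sequentially. alg_run \<alpha> lam T pop J n = Some st \<and>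
        alg_run \<alpha> lam T pop J n = Some (I, Q, S)"
      using assms that unfolding final_state_def by (rule eventually_conj[rotated])
    then obtain n where "alg_run \<alpha> lam T pop J n = Some st"
      "alg_run \<alpha> lam T pop J n = Some (I, Q, S)"
      by (auto simp: eventually_sequentially)
    then show ?thesis by simp
  qed
  then have "(THE st. final_state \<alpha> lam T pop J st) = (I, Q, S)"
    using assms by (intro the_equality)
  then show ?thesis using assms by (auto simp: algorithm1_def)
qed

lemma algorithm1_correct:
  "\<exists>I S t. algorithm1 \<alpha> lam T pop J = Some (I, S) \<and> feasible_solution lam T J I S \<and> charged t I"
proof -
  let ?r = "Min (release ` J)"
  \<comment> \<open>After \<open>N\<close> steps all deadlines have passed; the inserted 0 keeps
    \<open>Max\<close> meaningful for empty \<open>J\<close>.\<close>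
  define N where "N = nat (Max (insert 0 (deadline ` J)) - ?r)"
  have late: "deadline j \<le> ?r + int N" if "j \<in> J" for j
  proof -
    have "deadline j \<le> Max (insert 0 (deadline ` J))" using that finite_J by (intro Max_ge) auto
    then show ?thesis by (simp add: N_def)
  qed
  have released: "release j < ?r + int N" if "j \<in> J" for j
    using late[OF that] release_plus_L_le_deadline[OF that] L_pos lam_nonneg by linarith
  obtain I Q S where run: "alg_run \<alpha> lam T pop J N = Some (I, Q, S)"
    and inv: "invar (?r + int N) (I, Q, S)"
    using alg_run_invar[of N] by auto
  have fin: "finite Q" using inv finite_J by (auto simp: invar_def intro: finite_subset)
  \<comment> \<open>Every queued job is due by the current time, while the invariant bounds their
    number by the slots of an empty interval.\<close>
  have "Q = {}"
  proof (rule ccontr)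
    assume "Q \<noteq> {}"
    have "due Q (?r + int N) = Q" using inv late by (auto simp: invar_def due_def)
    moreover have "card (due Q (?r + int N)) \<le> slot_count lam T I (?r + int N) (?r + int N)"
      using inv lam_nonneg T_pos by (simp add: invar_def)
    ultimately show False using \<open>Q \<noteq> {}\<close> fin by (simp add: slot_count_def)
  qed
  have "alg_run \<alpha> lam T pop J n = Some (I, Q, S)" if "N \<le> n" for n
    using that
  proof (induction rule: dec_induct)
    case (step n)
    have "{j \<in> J. release j = ?r + int n} = {}" using released step(1) by force
    then show ?case using step \<open>Q = {}\<close> alg_step_idle by simp
  qed (fact run)
  then have "algorithm1 \<alpha> lam T pop J = Some (I, S)"
    by (intro algorithm1_eqI[of I Q]) (auto simp: final_state_def eventually_sequentially)
  moreover have "feasible_solution lam T J I S"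
  proof (rule feasible_solutionI[OF finite_J])
    show dom: "dom S = J" using inv released \<open>Q = {}\<close> by (auto simp: invar_def)
    show "feasible_at j (the (S j))" if j: "j \<in> J" for j
    proof -
      obtain \<tau> where "S j = Some \<tau>" using j dom by blast
      then show ?thesis using inv by (auto simp: invar_def)
    qed
    show "card {j \<in> J. S j = Some \<tau>} \<le> slots lam T I \<tau>" for \<tau>
      using inv by (simp add: invar_def)
  qed
  moreover have "charged (?r + int N) I" using inv by (simp add: invar_def)
  ultimately show ?thesis by blast
qed

lemma algorithm1_competitive:
  "\<exists>I S. algorithm1 \<alpha> lam T pop J = Some (I, S) \<and> feasible_solution lam T J I S \<and>
     int (size I) \<le> (\<lceil>1 / \<alpha>\<rceil> + 1) * int (OPT lam T J)"
proof -
  obtain I S t where alg: "algorithm1 \<alpha> lam T pop J = Some (I, S)"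
      "feasible_solution lam T J I S" "charged t I"
    using algorithm1_correct by blast
  \<comment> \<open>The algorithm's own solution shows that the set under \<open>LEAST\<close> is
    nonempty, so the minimum is attained.\<close>
  obtain I' S' where "feasible_solution lam T J I' S'" "size I' = OPT lam T J"
    using LeastI_ex[of "\<lambda>k. \<exists>I S. feasible_solution lam T J I S \<and> size I = k"] alg(2)
    unfolding OPT_def by blast
  then have "int (size I) \<le> int ((k + 1) * OPT lam T J)"
    using charged_size_le[OF alg(3)] by (metis of_nat_mono)
  then show ?thesis using alg by (auto simp: int_k algebra_simps)
qed

end

theorem theorem1:
  fixes \<alpha> :: real and lam T :: int and pop :: "job set \<Rightarrow> job"
  defines "Ins \<equiv> {J \<in> instances lam. \<forall>j\<in>J. long_window \<alpha> lam T j}"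
  assumes "0 < \<alpha>" and "\<alpha> < 1" and "0 \<le> lam" and "0 < T"
    and "smallest_deadline_rule pop"
  shows "competitive lam T Ins (algorithm1 \<alpha> lam T pop) (real_of_int (\<lceil>1 / \<alpha>\<rceil> + 1)) \<and>
    (\<forall>J\<in>Ins. \<exists>I S. algorithm1 \<alpha> lam T pop J = Some (I, S) \<and> feasible_solution lam T J I S \<and>
       int (size I) \<le> (\<lceil>1 / \<alpha>\<rceil> + 1) * int (OPT lam T J))"
proof -
  have main: "\<exists>I S. algorithm1 \<alpha> lam T pop J = Some (I, S) \<and> feasible_solution lam T J I S \<and>
       int (size I) \<le> (\<lceil>1 / \<alpha>\<rceil> + 1) * int (OPT lam T J)" if "J \<in> Ins" for J
  proof -
    interpret long_window_instance \<alpha> lam T pop J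
      using that assms by unfold_locales (auto simp: Ins_def instances_def)
    show ?thesis by (rule algorithm1_competitive)
  qed
  have "competitive lam T Ins (algorithm1 \<alpha> lam T pop) (real_of_int (\<lceil>1 / \<alpha>\<rceil> + 1))"
    unfolding competitive_def
  proof (rule exI[of _ 0], rule ballI)
    fix J assume "J \<in> Ins"
    then obtain I S where IS: "algorithm1 \<alpha> lam T pop J = Some (I, S)"
      "feasible_solution lam T J I S" "int (size I) \<le> (\<lceil>1 / \<alpha>\<rceil> + 1) * int (OPT lam T J)"
      using main by blast
    from IS(3) have "real_of_int (int (size I)) \<le> real_of_int ((\<lceil>1 / \<alpha>\<rceil> + 1) * int (OPT lam T J))"
      by (simp only: of_int_le_iff)
    then have "real (size I) \<le> real_of_int (\<lceil>1 / \<alpha>\<rceil> + 1) * real (OPT lam T J) + 0"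
      by simp
    then show "\<exists>I S. algorithm1 \<alpha> lam T pop J = Some (I, S) \<and> feasible_solution lam T J I S \<and>
        real (size I) \<le> real_of_int (\<lceil>1 / \<alpha>\<rceil> + 1) * real (OPT lam T J) + 0"
      using IS(1,2) by blast
  qed
  then show ?thesis using main by blast
qed

end
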